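(* Let $G$ be an abelian group containing a torsion subgroup $T$ such that $G/T$ is a countable torsion-free group. Let $p$ be a prime and let $B_p$ be a basic subgroup of the $p$-primary component of $T$. Then $B_p$ is an endomorphic image of $G$, i.e., there is a homomorphism $G\to B_p$ which is surjective.
   Context: All groups are abelian. A basic subgroup $B$ of a $p$-group $A$ is a subgroup that is a direct sum of cyclic groups, is pure in $A$, and has $A/B$ divisible. *)

theory Defs
  imports "HOL-Algebra.Algebra" "HOL-Computational_Algebra.Primes"
begin

text \<open>All groups are abelian, written multiplicatively (HOL-Algebra). Subgroups of
  the ambient group G are represented by their carrier sets.\<close>

definition torsion_set :: "('a, 'b) monoid_scheme \<Rightarrow> 'a set \<Rightarrow> bool" where
  "torsion_set G T \<longleftrightarrow> (\<forall>x\<in>T. \<exists>n::nat. n > 0 \<and> x [^]\<^bsub>G\<^esub> n = \<one>\<^bsub>G\<^esub>)"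

definition torsion_free :: "('a, 'b) monoid_scheme \<Rightarrow> bool" where
  "torsion_free H \<longleftrightarrow>
     (\<forall>x\<in>carrier H. \<forall>n::nat. n > 0 \<and> x [^]\<^bsub>H\<^esub> n = \<one>\<^bsub>H\<^esub> \<longrightarrow> x = \<one>\<^bsub>H\<^esub>)"

definition primary_component :: "('a, 'b) monoid_scheme \<Rightarrow> nat \<Rightarrow> 'a set \<Rightarrow> 'a set" where
  "primary_component G p T = {x\<in>T. \<exists>k::nat. x [^]\<^bsub>G\<^esub> (p ^ k) = \<one>\<^bsub>G\<^esub>}"

definition direct_sum_of_cyclics :: "('a, 'b) monoid_scheme \<Rightarrow> 'a set \<Rightarrow> bool" where
  "direct_sum_of_cyclics G B \<longleftrightarrow>
     (\<exists>S. S \<subseteq> B \<and> generate G S = B \<and>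
        (\<forall>F. \<forall>n :: 'a \<Rightarrow> int. finite F \<and> F \<subseteq> S \<and>
            finprod G (\<lambda>x. x [^]\<^bsub>G\<^esub> (n x)) F = \<one>\<^bsub>G\<^esub>
            \<longrightarrow> (\<forall>x\<in>F. x [^]\<^bsub>G\<^esub> (n x) = \<one>\<^bsub>G\<^esub>)))"

definition pure_in :: "('a, 'b) monoid_scheme \<Rightarrow> 'a set \<Rightarrow> 'a set \<Rightarrow> bool" where
  "pure_in G B A \<longleftrightarrow>
     (\<forall>n::nat. \<forall>b\<in>B. (\<exists>a\<in>A. a [^]\<^bsub>G\<^esub> n = b) \<longrightarrow> (\<exists>c\<in>B. c [^]\<^bsub>G\<^esub> n = b))"

definition divisible_quotient :: "('a, 'b) monoid_scheme \<Rightarrow> 'a set \<Rightarrow> 'a set \<Rightarrow> bool" where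
  "divisible_quotient G A B \<longleftrightarrow>
     (\<forall>a\<in>A. \<forall>n::nat. n > 0 \<longrightarrow> (\<exists>y\<in>A. \<exists>b\<in>B. a = y [^]\<^bsub>G\<^esub> n \<otimes>\<^bsub>G\<^esub> b))"

definition basic_subgroup :: "('a, 'b) monoid_scheme \<Rightarrow> 'a set \<Rightarrow> 'a set \<Rightarrow> bool" where
  "basic_subgroup G B A \<longleftrightarrow>
     subgroup B G \<and> B \<subseteq> A \<and> direct_sum_of_cyclics G B \<and> pure_in G B A \<and>
     divisible_quotient G A B"

end

theory Submission
  imports Defs
begin

text \<open>
  Let \<open>U\<close> be a basis of \<open>Bp\<close>. As \<open>Bp\<close> is pure in \<open>G\<close>, for each \<open>m\<close> the subgroup
  generated by the elements of \<open>U\<close> of order \<open>m\<close> has a complement in \<open>G\<close> that contains the other elements of \<open>U\<close>. So every \<open>x \<in> U\<close> has a coordinate function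
  \<open>c x\<close> from \<open>G\<close> to the integers modulo the order of \<open>x\<close>, and for \<open>g \<in> G\<close> only finitely many
  \<open>c x g\<close> with \<open>x\<close> of a given order are nonzero. The product over \<open>U\<close> of the \<open>x [^] c x g\<close> may
  still be infinite.

  Choose \<open>m\<close> such that the cardinality of \<open>D = {x \<in> U. m \<le> ord x}\<close> is least possible, and for
  \<open>x \<in> D\<close> replace \<open>c x\<close> by \<open>c (k x) - c (l x)\<close>, where \<open>k x\<close> and \<open>l x\<close> are distinct elements of
  \<open>D\<close>, all different for different \<open>x\<close>, whose orders are at least the square of that of \<open>x\<close>.
  The gap between the orders makes the product finite on torsion elements. Since \<open>G Mod T\<close> is
  countable, it remains to treat a sequence of coset representatives: if \<open>D\<close> is countable, the
  pigeonhole principle provides \<open>k x\<close> and \<open>l x\<close> with equal coordinates at an initial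
  segment of the sequence; otherwise \<open>k x\<close> and \<open>l x\<close> can avoid the countably many elements with
  a nonzero coordinate at some representative. The resulting map is onto because it sends \<open>k x\<close>
  to \<open>x\<close>.
\<close>

subsection \<open>Choice of partner indices\<close>

text \<open>Recursion along the well-order \<open>|I|\<close>: every proper initial segment has
  cardinality smaller than \<open>|I|\<close>, so the values used earlier cannot exhaust
  \<open>S i\<close> and a fresh one remains.\<close>

lemma injective_choice:
  assumes "\<And>i. i \<in> I \<Longrightarrow> |I| \<le>o |S i|"
  obtains f where "inj_on f I" "\<And>i. i \<in> I \<Longrightarrow> f i \<in> S i"
proof -
  define r where "r = |I|"
  have wo: "Well_order r" and Fr: "Field r = I" and co: "Card_order r"
    by (simp_all add: r_def card_of_Well_order Field_card_of card_of_Card_order)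
  define R where "R = r - Id"
  have wf: "wf R"
    using wo unfolding R_def well_order_on_def by blast
  define f where "f = wfrec R (\<lambda>f i. SOME y. y \<in> S i - f ` underS r i)"
  have under: "(j, i) \<in> R \<longleftrightarrow> j \<in> underS r i" for i j
    by (auto simp: R_def underS_def)
  have f: "f i = (SOME y. y \<in> S i - f ` underS r i)" for i
  proof -
    have "cut f R i ` underS r i = f ` underS r i"
      by (rule image_cong) (auto simp: cut_def under)
    then show ?thesis
      using def_wfrec[OF f_def[THEN eq_reflection] wf, of i] by simp
  qed
  have step: "f i \<in> S i - f ` underS r i" if "i \<in> I" for i
  proof -
    have "|f ` underS r i| <o |I|"
      using ordLeq_ordLess_trans[OF card_of_image card_of_underS[OF co]] that Fr
      by (metis r_def)
    then have "\<not> S i \<subseteq> f ` underS r i"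
      using assms[OF that] card_of_mono1 not_ordLess_ordLeq ordLeq_transitive by blast
    then have "\<exists>y. y \<in> S i - f ` underS r i"
      by blast
    then show ?thesis
      unfolding f[of i] by (rule someI_ex)
  qed
  have "inj_on f I"
  proof (rule inj_onI, rule ccontr)
    fix i j assume ij: "i \<in> I" "j \<in> I" "f i = f j" "i \<noteq> j"
    have "total_on I r"
      using wo Fr unfolding well_order_on_def linear_order_on_def by auto
    then have "i \<in> underS r j \<or> j \<in> underS r i"
      using ij by (auto simp: total_on_def underS_def)
    then show False
      using step ij by (metis Diff_iff image_eqI)
  qed
  then show thesis
    using that step by blast
qed

lemma card_of_Times_nat:
  assumes "infinite A"
  shows "|A \<times> (UNIV :: nat set)| =o |A|"
  by (rule conjunct1[OF card_of_Times_infinite[OF assms UNIV_not_empty assms[unfolded infinite_iff_card_of_nat]]])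

text \<open>Cardinals are well-founded, so some tail of \<open>w\<close> has least cardinality.
  Cutting it further at \<open>n\<close> yields the tail from \<open>max m n\<close>, which cannot
  be smaller.\<close>

lemma ex_minimal_tail:
  fixes w :: "'a \<Rightarrow> nat"
  obtains m where "\<And>n. card_of {x \<in> U. m \<le> w x} \<le>o card_of {x \<in> U. m \<le> w x \<and> n \<le> w x}"
proof -
  obtain r where r: "r \<in> range (\<lambda>m. card_of {x \<in> U. m \<le> w x})"
    "\<And>s. (s, r) \<in> ordLess \<Longrightarrow> s \<notin> range (\<lambda>m. card_of {x \<in> U. m \<le> w x})"
    using wfE_min[OF wf_ordLess, of _ "range (\<lambda>m. card_of {x \<in> U. m \<le> w x})"] by blast
  then obtain m where m: "r = card_of {x \<in> U. m \<le> w x}" by blast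
  have "card_of {x \<in> U. m \<le> w x} \<le>o card_of {x \<in> U. m \<le> w x \<and> n \<le> w x}" for n
  proof -
    have "{x \<in> U. m \<le> w x \<and> n \<le> w x} = {x \<in> U. max m n \<le> w x}" by auto
    moreover have "\<not> card_of {x \<in> U. max m n \<le> w x} <o r"
      using r(2) by blast
    ultimately show ?thesis
      using m by (metis card_of_Well_order not_ordLess_iff_ordLeq)
  qed
  then show thesis using that by blast
qed

text \<open>The tuples of residues modulo \<open>q\<close> at the arguments up to \<open>i\<close>
  form a finite set, whereas \<open>s\<close> ranges over all naturals.\<close>

lemma pigeonhole_residues:
  fixes c :: "nat \<Rightarrow> nat \<Rightarrow> int" and q :: int
  assumes "q > 0"
  obtains s t where "s \<noteq> t" "\<And>j. j \<le> i \<Longrightarrow> q dvd c s j - c t j"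
proof -
  define F where "F s = (\<lambda>j\<in>{..i}. c s j mod q)" for s
  have "range F \<subseteq> PiE {..i} (\<lambda>_. {0..<q})"
    using assms by (auto simp: F_def)
  moreover have "finite (PiE {..i} (\<lambda>_. {0..<q}))"
    by (intro finite_PiE) auto
  ultimately have "\<not> inj F"
    using finite_subset range_inj_infinite by blast
  then obtain s t where st: "s \<noteq> t" "F s = F t"
    by (auto simp: inj_def)
  have "q dvd c s j - c t j" if "j \<le> i" for j
    using fun_cong[OF st(2), of j] that by (simp add: F_def mod_eq_dvd_iff)
  with st(1) that show thesis by blast
qed

text \<open>In the application \<open>w\<close> is the order and \<open>c x j\<close> the coordinate
  at \<open>x\<close> of the \<open>j\<close>-th coset representative. Each \<open>x\<close> first
  receives infinitely many candidates, disjoint from those of the other elements; its partners are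
  two of them.\<close>

lemma ex_partner_indices:
  fixes w :: "'a \<Rightarrow> nat" and c :: "'a \<Rightarrow> nat \<Rightarrow> int"
  assumes tail: "\<And>n. |D| \<le>o card_of {x \<in> D. n \<le> w x}"
    and pos: "\<And>x. x \<in> D \<Longrightarrow> w x > 0"
    and dvd: "\<And>x y. x \<in> D \<Longrightarrow> y \<in> D \<Longrightarrow> w x \<le> w y \<Longrightarrow> w x dvd w y"
    and fin: "\<And>m j. finite {x \<in> D. w x = m \<and> \<not> int (w x) dvd c x j}"
  obtains k l where
    "\<And>x. x \<in> D \<Longrightarrow> k x \<in> D" "\<And>x. x \<in> D \<Longrightarrow> l x \<in> D"
    "\<And>x. x \<in> D \<Longrightarrow> (w x)\<^sup>2 \<le> w (k x)" "\<And>x. x \<in> D \<Longrightarrow> (w x)\<^sup>2 \<le> w (l x)"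
    "inj_on k D" "inj_on l D" "\<And>x y. x \<in> D \<Longrightarrow> y \<in> D \<Longrightarrow> k x \<noteq> l y"
    "\<And>j. finite {x \<in> D. \<not> int (w x) dvd c (k x) j - c (l x) j}"
proof (cases "finite D")
  case True
  then obtain n where n: "\<And>x. x \<in> D \<Longrightarrow> w x < n"
    by (metis finite_nat_set_iff_bounded finite_imageI imageI)
  \<comment> \<open>The weights on a finite \<open>D\<close> are bounded, so some tail is empty and
    \<open>tail\<close> forces \<open>D\<close> to be empty.\<close>
  have "{x \<in> D. n \<le> w x} = {}"
    using n by fastforce
  then have "D = {}"
    using tail[of n] by (metis card_of_empty3)
  then show thesis
    using that[of id id] by simp
next
  case inf: False
  define Z where "Z = {x \<in> D. \<exists>j. \<not> int (w x) dvd c x j}"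
  have Z: "countable Z"
  proof -
    have "Z = (\<Union>(m, j). {x \<in> D. w x = m \<and> \<not> int (w x) dvd c x j})"
      by (auto simp: Z_def)
    also have "countable \<dots>"
      using fin by (intro countable_UN) (auto intro: countable_finite)
    finally show ?thesis .
  qed
  \<comment> \<open>An uncountable \<open>D\<close> can spare the countable set \<open>Z\<close>,
    off which every coordinate at a representative vanishes. A countable \<open>D\<close> may lie
    inside \<open>Z\<close> and relies on the pigeonhole principle.\<close>
  define E where "E = (if countable D then D else D - Z)"
  have ED: "E \<subseteq> D" by (auto simp: E_def)
  have tailE: "|D| \<le>o card_of {x \<in> E. n \<le> w x}" for n
  proof (cases "countable D")
    case True
    then show ?thesis using tail by (simp add: E_def)
  next
    case False
    let ?V = "{x \<in> D. n \<le> w x}"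
    have V: "\<not> countable ?V"
      using tail[of n] False by (meson card_of_ordLeq countable_image_inj_on countable_subset)
    have "|Z| <o |?V|"
    proof (rule ccontr)
      assume "\<not> ?thesis"
      then have "|?V| \<le>o |Z|" by simp
      then show False
        using V Z by (meson card_of_ordLeq countable_image_inj_on countable_subset)
    qed
    then have "|?V - Z| =o |?V|"
      using V countable_finite card_of_Un_diff_infinite by blast
    moreover have "?V - Z = {x \<in> E. n \<le> w x}"
      using False by (auto simp: E_def)
    ultimately show ?thesis
      using ordLeq_ordIso_trans[OF tail[of n] ordIso_symmetric] by simp
  qed
  \<comment> \<open>Injectivity of \<open>e\<close> is available and used only for countable
    \<open>D\<close>: agreement at all \<open>j \<le> e x\<close> leaves, for a fixed
    \<open>j\<close>, only the finitely many \<open>x\<close> with \<open>e x < j\<close>.\<close>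
  define e :: "'a \<Rightarrow> nat" where "e = to_nat_on D"
  \<comment> \<open>As \<open>D\<close> is infinite, its product with the naturals is no larger than
    \<open>D\<close>, hence no larger than any tail of \<open>E\<close>.\<close>
  obtain f where f: "inj_on f (D \<times> (UNIV :: nat set))"
    "\<And>i. i \<in> D \<times> (UNIV :: nat set) \<Longrightarrow> f i \<in> {y \<in> E. (w (fst i))\<^sup>2 \<le> w y}"
    using injective_choice[of "D \<times> (UNIV :: nat set)" "\<lambda>i. {y \<in> E. (w (fst i))\<^sup>2 \<le> w y}"]
      ordIso_ordLeq_trans[OF card_of_Times_nat[OF inf] tailE] by blast
  have "\<exists>s t. s \<noteq> t \<and> (\<forall>j \<le> e x. int (w x) dvd c (f (x, s)) j - c (f (x, t)) j)"
    if "x \<in> D" for x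
  proof -
    have "int (w x) > 0"
      using pos[OF that] by simp
    then show ?thesis
      by (rule pigeonhole_residues[of _ "e x" "\<lambda>s. c (f (x, s))"]) blast
  qed
  then obtain s t where st: "\<And>x. x \<in> D \<Longrightarrow> s x \<noteq> t x"
    "\<And>x j. x \<in> D \<Longrightarrow> j \<le> e x \<Longrightarrow> int (w x) dvd c (f (x, s x)) j - c (f (x, t x)) j"
    by metis
  have sq: "w x \<le> (w x)\<^sup>2" for x by (simp add: power2_eq_square)
  show thesis
  proof (rule that[of "\<lambda>x. f (x, s x)" "\<lambda>x. f (x, t x)"])
    fix j
    show "finite {x \<in> D. \<not> int (w x) dvd c (f (x, s x)) j - c (f (x, t x)) j}" (is "finite ?S")
    proof (cases "countable D")
      case True
      have "?S \<subseteq> D \<inter> e -` {..<j}"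
        using st(2)[of _ j] by (auto simp: not_less[symmetric])
      moreover have "inj_on e D"
        using True by (simp add: e_def inj_on_to_nat_on)
      ultimately show ?thesis
        using finite_subset[OF _ finite_vimage_IntI[of "{..<j}" e D]] by (simp add: Int_commute)
    next
      case False
      \<comment> \<open>Off \<open>Z\<close> the coordinate is divisible by the weight of the
        candidate itself, and \<open>w x\<close> divides that weight.\<close>
      have "int (w x) dvd c (f (x, s)) j" if "x \<in> D" for x s
      proof -
        have *: "f (x, s) \<in> D - Z" "(w x)\<^sup>2 \<le> w (f (x, s))"
          using f(2)[of "(x, s)"] that False by (auto simp: E_def)
        then have "int (w x) dvd int (w (f (x, s)))"
          using dvd[of x "f (x, s)"] that sq[of x] by simp
        also have "\<dots> dvd c (f (x, s)) j"
          using *(1) by (auto simp: Z_def)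
        finally show ?thesis .
      qed
      then have "?S = {}" by auto
      then show ?thesis by (metis finite.emptyI)
    qed
  next
    fix x assume "x \<in> D"
    then show "f (x, s x) \<in> D" "f (x, t x) \<in> D" "(w x)\<^sup>2 \<le> w (f (x, s x))" "(w x)\<^sup>2 \<le> w (f (x, t x))"
      using f(2)[of "(x, s x)"] f(2)[of "(x, t x)"] ED by auto
  next
    show "inj_on (\<lambda>x. f (x, s x)) D" "inj_on (\<lambda>x. f (x, t x)) D"
      using f(1) by (auto simp: inj_on_def)
  next
    fix x y assume "x \<in> D" "y \<in> D"
    then show "f (x, s x) \<noteq> f (y, t y)"
      using f(1) st(1)[of x] by (auto simp: inj_on_def)
  qed
qed

text \<open>The factors \<open>p\<close> are distributed between \<open>N\<close> and
  \<open>c\<close>: at most \<open>p ^ e\<close> goes into \<open>c\<close>, and the rest divides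
  \<open>N\<close>. This serves to bound the orders of the basis elements at which a torsion element
  has a nonzero coordinate.\<close>

lemma prime_power_le_mult:
  fixes c :: int
  assumes p: "Factorial_Ring.prime (p::nat)" and "int (p ^ n) dvd int N * c" "\<not> int (p ^ e) dvd c" "N > 0"
  shows "p ^ n \<le> N * p ^ e"
proof -
  have "prime_elem (int p)" using p by simp
  then obtain a b where ab: "a + b = n" "int p ^ a dvd int N" "int p ^ b dvd c"
    using prime_elem_power_dvd_prod[of "int p" n "int N" c] assms(2) by auto
  have "b \<le> e"
    using assms(3) ab(3) by (metis le_imp_power_dvd dvd_trans of_nat_power nat_le_linear)
  moreover have "p ^ a \<le> N"
    using ab(2) assms(4) by (metis dvd_imp_le int_dvd_int_iff of_nat_power)
  moreover have "p > 0" using p by (rule prime_gt_0_nat)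
  ultimately have "p ^ a * p ^ b \<le> N * p ^ e"
    by (intro mult_le_mono) (auto intro: power_increasing)
  then show ?thesis by (simp flip: ab(1) add: power_add)
qed

context comm_group
begin

subsection \<open>Complements\<close>

lemma subgroup_chain_Union:
  assumes "\<C> \<noteq> {}" "\<And>H. H \<in> \<C> \<Longrightarrow> subgroup H G" "\<And>H K. H \<in> \<C> \<Longrightarrow> K \<in> \<C> \<Longrightarrow> H \<subseteq> K \<or> K \<subseteq> H"
  shows "subgroup (\<Union>\<C>) G"
proof (rule subgroupI)
  show "\<Union>\<C> \<subseteq> carrier G" "\<Union>\<C> \<noteq> {}"
    using assms(1,2) subgroup.subset subgroup.one_closed by fastforce+
  show "inv a \<in> \<Union>\<C>" if "a \<in> \<Union>\<C>" for a
    using that subgroup.m_inv_closed[OF assms(2)] by blast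
  show "a \<otimes> b \<in> \<Union>\<C>" if ab: "a \<in> \<Union>\<C>" "b \<in> \<Union>\<C>" for a b
  proof -
    obtain H K where "H \<in> \<C>" "a \<in> H" "K \<in> \<C>" "b \<in> K" using ab by blast
    then obtain M where "M \<in> \<C>" "a \<in> M" "b \<in> M" using assms(3)[of H K] by blast
    then show ?thesis using subgroup.m_closed[OF assms(2)] by blast
  qed
qed

lemma pow_in_subgroup:
  assumes "subgroup H G" "x \<in> H"
  shows "x [^] (n::nat) \<in> H"
  using subgroup_int_pow_closed[OF assms, of "int n"] by (simp add: int_pow_int)

lemma subset_set_mult:
  assumes "subgroup H G" "subgroup K G"
  shows "H \<subseteq> H <#> K" "K \<subseteq> H <#> K"
proof -
  have "x \<otimes> \<one> \<in> H <#> K" if "x \<in> H" for x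
    using that subgroup.one_closed[OF assms(2)] unfolding set_mult_def by blast
  then show "H \<subseteq> H <#> K"
    using subgroup.mem_carrier[OF assms(1)] by auto
  have "\<one> \<otimes> x \<in> H <#> K" if "x \<in> K" for x
    using that subgroup.one_closed[OF assms(1)] unfolding set_mult_def by blast
  then show "K \<subseteq> H <#> K"
    using subgroup.mem_carrier[OF assms(2)] by auto
qed

text \<open>The assumption \<open>hom\<close> holds when \<open>C\<close> is a direct sum of cyclic groups all of order
  \<open>p ^ Suc m\<close>. Any \<open>K\<close> maximal among the subgroups that contain \<open>L\<close> and meet \<open>C\<close> trivially is
  a complement.\<close>

lemma homogeneous_complement:
  assumes L: "subgroup L G" and C: "subgroup C G" and p: "Factorial_Ring.prime (p::nat)"
    and LC: "L \<inter> C = {\<one>}"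
    and pow: "\<And>g. g \<in> carrier G \<Longrightarrow> g [^] (p ^ Suc m) \<in> L"
    and hom: "\<And>c. c \<in> C \<Longrightarrow> c [^] (p ^ m) = \<one> \<Longrightarrow> \<exists>d\<in>C. c = d [^] p"
  obtains K where "subgroup K G" "L \<subseteq> K" "K \<inter> C = {\<one>}" "K <#> C = carrier G"
proof -
  define \<A> where "\<A> = {K. subgroup K G \<and> L \<subseteq> K \<and> K \<inter> C = {\<one>}}"
  have "\<Union>\<C> \<in> \<A>" if "\<C> \<noteq> {}" "subset.chain \<A> \<C>" for \<C>
  proof -
    have "subgroup (\<Union>\<C>) G"
      using that by (intro subgroup_chain_Union) (auto simp: subset_chain_def \<A>_def)
    then show ?thesis
      using that by (fastforce simp: \<A>_def subset_chain_def)
  qed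
  then obtain K where "K \<in> \<A>" and max: "\<And>M. M \<in> \<A> \<Longrightarrow> K \<subseteq> M \<Longrightarrow> M = K"
    using subset_Zorn_nonempty[of \<A>] L LC by (auto simp: \<A>_def)
  then have K: "subgroup K G" "L \<subseteq> K" "K \<inter> C = {\<one>}" by (auto simp: \<A>_def)
  have KC: "subgroup (K <#> C) G" using mult_subgroups[OF K(1) C] .
  have carr [simp]: "x \<in> K \<Longrightarrow> x \<in> carrier G" "x \<in> C \<Longrightarrow> x \<in> carrier G" for x
    using K(1) C subgroup.mem_carrier by metis+
  have "K \<subseteq> K <#> C" "C \<subseteq> K <#> C"
    using subset_set_mult[OF K(1) C] by auto
  \<comment> \<open>If \<open>g\<close> is not in \<open>K\<close>, maximality yields a nontrivial
    \<open>c = k \<otimes> g [^] s\<close> in \<open>C\<close>. Then \<open>p\<close> does not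
    divide \<open>s\<close>, and a Bezout identity recovers \<open>g\<close> from powers of
    \<open>g [^] p\<close> and \<open>g [^] s\<close>.\<close>
  have key: "g \<in> K <#> C" if g: "g \<in> carrier G" and gp: "g [^] p \<in> K" for g
  proof (cases "g \<in> K")
    case True
    then show ?thesis using \<open>K \<subseteq> K <#> C\<close> by blast
  next
    case False
    define M where "M = K <#> generate G {g}"
    have gen: "subgroup (generate G {g}) G" using g by (simp add: generate_is_subgroup)
    have M: "subgroup M G" unfolding M_def using mult_subgroups[OF K(1) gen] .
    have KM: "K \<subseteq> M" "g \<in> M"
      using subset_set_mult[OF K(1) gen] generate.incl[of g "{g}" G] unfolding M_def by auto
    then have "M \<inter> C \<noteq> {\<one>}"
      using False max[of M] M K(2) by (auto simp: \<A>_def)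
    then obtain c where c: "c \<in> M" "c \<in> C" "c \<noteq> \<one>"
      using subgroup.one_closed[OF C] subgroup.one_closed[OF M] by blast
    then obtain k s where k: "k \<in> K" and cks: "c = k \<otimes> g [^] (s::int)"
      unfolding M_def set_mult_def generate_pow[OF g] by blast
    have gp': "g [^] (int p * i) \<in> K" for i
      using subgroup_int_pow_closed[OF K(1) gp, of i] g
      by (simp add: int_pow_int[symmetric] int_pow_pow)
    have "\<not> int p dvd s"
    proof
      assume "int p dvd s"
      then have "c \<in> K" using gp' cks k subgroup.m_closed[OF K(1)] by auto
      then show False using c K(3) by blast
    qed
    then have "coprime (int p) s"
      using p by (intro prime_imp_coprime) auto
    then obtain u v where "u * int p + v * s = 1"
      using bezout_int[of "int p" s] by auto
    then have "g = g [^] (int p * u + s * v)"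
      using g by (simp add: algebra_simps)
    also have "\<dots> = g [^] (int p * u) \<otimes> (g [^] s) [^] v"
      using g by (simp add: int_pow_mult int_pow_pow)
    finally have eq: "g = g [^] (int p * u) \<otimes> (g [^] s) [^] v" .
    have "g [^] s = inv k \<otimes> c"
      unfolding cks using g k by (simp add: m_assoc[symmetric])
    then have "g [^] s \<in> K <#> C"
      using k c(2) subgroup.m_inv_closed[OF K(1)] by (auto simp: set_mult_def)
    then have "g [^] (int p * u) \<otimes> (g [^] s) [^] v \<in> K <#> C"
      using subgroup.m_closed[OF KC] subgroup_int_pow_closed[OF KC] gp' \<open>K \<subseteq> K <#> C\<close> by blast
    then show ?thesis using eq by simp
  qed
  \<comment> \<open>Write \<open>g [^] p = k \<otimes> c\<close>. Raising to the power
    \<open>p ^ m\<close> puts \<open>c [^] (p ^ m)\<close> into \<open>K \<inter> C\<close>, so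
    \<open>hom\<close> gives a root \<open>d\<close> of \<open>c\<close>, and
    \<open>g \<otimes> inv d\<close> falls under \<open>key\<close>.\<close>
  have key2: "g \<in> K <#> C" if g: "g \<in> carrier G" and gp: "g [^] p \<in> K <#> C" for g
  proof -
    obtain k c where kc: "k \<in> K" "c \<in> C" "g [^] p = k \<otimes> c"
      using gp by (auto simp: set_mult_def)
    have "g [^] (p ^ Suc m) = k [^] (p ^ m) \<otimes> c [^] (p ^ m)"
      using kc g by (simp add: nat_pow_pow[symmetric] nat_pow_distrib)
    then have "c [^] (p ^ m) = inv (k [^] (p ^ m)) \<otimes> g [^] (p ^ Suc m)"
      using kc g by (simp add: m_assoc[symmetric])
    also have "\<dots> \<in> K"
      using pow[OF g] K kc(1) pow_in_subgroup[OF K(1)]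
      by (meson subgroup.m_closed subgroup.m_inv_closed subsetD)
    finally have "c [^] (p ^ m) = \<one>"
      using K(3) pow_in_subgroup[OF C kc(2)] by blast
    then obtain d where d: "d \<in> C" "c = d [^] p" using hom kc(2) by blast
    have "(g \<otimes> inv d) [^] p = k"
      using kc d g by (simp add: nat_pow_distrib nat_pow_inv m_assoc)
    then have "g \<otimes> inv d \<in> K <#> C"
      using key[of "g \<otimes> inv d"] kc(1) d(1) g by simp
    then have "(g \<otimes> inv d) \<otimes> d \<in> K <#> C"
      using subgroup.m_closed[OF KC] d(1) \<open>C \<subseteq> K <#> C\<close> by blast
    then show ?thesis using g d(1) by (simp add: m_assoc)
  qed
  \<comment> \<open>Roots are extracted one factor \<open>p\<close> at a time; the start is that all
    powers with exponent \<open>p ^ Suc m\<close> lie in \<open>L\<close>.\<close>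
  have "g \<in> K <#> C" if "g \<in> carrier G" "g [^] (p ^ j) \<in> K <#> C" for g j
    using that
  proof (induction j arbitrary: g)
    case 0
    then show ?case by (simp add: nat_pow_eone)
  next
    case (Suc j)
    have "(g [^] p) [^] (p ^ j) = g [^] (p ^ Suc j)"
      using Suc.prems(1) by (simp add: nat_pow_pow)
    then have "g [^] p \<in> K <#> C"
      using Suc.IH[of "g [^] p"] Suc.prems by simp
    then show ?case
      by (rule key2[OF Suc.prems(1)])
  qed
  then have "carrier G \<subseteq> K <#> C"
    using pow K(2) \<open>K \<subseteq> K <#> C\<close> by blast
  then have "K <#> C = carrier G"
    using subgroup.subset[OF KC] by blast
  then show thesis using that K by blast
qed

subsection \<open>Integer combinations of a family\<close>

text \<open>\<open>gfinprod\<close> defaults to \<open>\<one>\<close> when infinitely many factors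
  are nontrivial, so the value is meaningful only together with \<open>fin_supp\<close>.\<close>

definition lincomb :: "'a set \<Rightarrow> ('a \<Rightarrow> int) \<Rightarrow> 'a"
  where "lincomb U \<nu> = gfinprod G (\<lambda>x. x [^] \<nu> x) U"

text \<open>Nontrivial factors are counted, not nonzero coefficients, because a coefficient matters
  only modulo the order of \<open>x\<close>.\<close>

definition fin_supp :: "'a set \<Rightarrow> ('a \<Rightarrow> int) \<Rightarrow> bool"
  where "fin_supp U \<nu> \<longleftrightarrow> finite {x \<in> U. x [^] \<nu> x \<noteq> \<one>}"

text \<open>Directness of the sum of the cyclic groups generated by the elements of
  \<open>U\<close>: factors, not coefficients, are forced to be trivial, which admits elements of
  finite order.\<close>

definition independent :: "'a set \<Rightarrow> bool"
  where "independent U \<longleftrightarrow>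
    (\<forall>\<nu>. fin_supp U \<nu> \<and> lincomb U \<nu> = \<one> \<longrightarrow> (\<forall>x\<in>U. x [^] \<nu> x = \<one>))"

lemma lincomb_closed [simp]: "U \<subseteq> carrier G \<Longrightarrow> lincomb U \<nu> \<in> carrier G"
  unfolding lincomb_def by (rule gfinprod_closed) auto

lemma lincomb_cong:
  assumes "U \<subseteq> carrier G" "\<And>x. x \<in> U \<Longrightarrow> x [^] \<mu> x = x [^] \<nu> x"
  shows "lincomb U \<mu> = lincomb U \<nu>"
  unfolding lincomb_def using assms by (intro gfinprod_cong) (auto simp: simp_implies_def)

lemma lincomb_zero [simp]: "lincomb U (\<lambda>x. 0) = \<one>"
  by (simp add: lincomb_def gfinprod_def)

lemma fin_supp_zero [simp]: "fin_supp U (\<lambda>x. 0)"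
  by (simp add: fin_supp_def)

lemma fin_supp_add:
  assumes "U \<subseteq> carrier G" "fin_supp U \<mu>" "fin_supp U \<nu>"
  shows "fin_supp U (\<lambda>x. \<mu> x + \<nu> x)"
proof -
  have "{x \<in> U. x [^] (\<mu> x + \<nu> x) \<noteq> \<one>} \<subseteq> {x \<in> U. x [^] \<mu> x \<noteq> \<one>} \<union> {x \<in> U. x [^] \<nu> x \<noteq> \<one>}"
    using assms(1) by (auto simp: int_pow_mult subset_iff)
  then show ?thesis
    using assms(2,3) by (auto simp: fin_supp_def intro: finite_subset)
qed

lemma lincomb_add:
  assumes "U \<subseteq> carrier G" "fin_supp U \<mu>" "fin_supp U \<nu>"
  shows "lincomb U (\<lambda>x. \<mu> x + \<nu> x) = lincomb U \<mu> \<otimes> lincomb U \<nu>"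
proof -
  have "lincomb U (\<lambda>x. \<mu> x + \<nu> x) = gfinprod G (\<lambda>x. x [^] \<mu> x \<otimes> x [^] \<nu> x) U"
    unfolding lincomb_def using assms(1)
    by (intro gfinprod_cong) (auto simp: simp_implies_def int_pow_mult subset_iff)
  also have "\<dots> = lincomb U \<mu> \<otimes> lincomb U \<nu>"
    unfolding lincomb_def using assms by (intro gfinprod_distrib) (auto simp: fin_supp_def)
  finally show ?thesis .
qed

lemma fin_supp_mult:
  assumes "U \<subseteq> carrier G" "fin_supp U \<nu>"
  shows "fin_supp U (\<lambda>x. k * \<nu> x)"
proof -
  have "{x \<in> U. x [^] (k * \<nu> x) \<noteq> \<one>} \<subseteq> {x \<in> U. x [^] \<nu> x \<noteq> \<one>}"
    using assms(1) by (auto simp: int_pow_eq_id subset_iff)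
  then show ?thesis
    using assms(2) by (auto simp: fin_supp_def intro: finite_subset)
qed

lemma fin_supp_minus: "U \<subseteq> carrier G \<Longrightarrow> fin_supp U \<nu> \<Longrightarrow> fin_supp U (\<lambda>x. - \<nu> x)"
  using fin_supp_mult[of U \<nu> "-1"] by simp

lemma fin_supp_diff:
  "U \<subseteq> carrier G \<Longrightarrow> fin_supp U \<mu> \<Longrightarrow> fin_supp U \<nu> \<Longrightarrow> fin_supp U (\<lambda>x. \<mu> x - \<nu> x)"
  using fin_supp_add[of U \<mu> "\<lambda>x. - \<nu> x"] fin_supp_minus[of U \<nu>] by simp

lemma lincomb_minus:
  assumes "U \<subseteq> carrier G" "fin_supp U \<nu>"
  shows "lincomb U (\<lambda>x. - \<nu> x) = inv (lincomb U \<nu>)"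
  using lincomb_add[OF assms(1) fin_supp_minus[OF assms] assms(2)] assms
  by (intro inv_equality[symmetric]) auto

lemma lincomb_diff:
  assumes "U \<subseteq> carrier G" "fin_supp U \<mu>" "fin_supp U \<nu>"
  shows "lincomb U (\<lambda>x. \<mu> x - \<nu> x) = lincomb U \<mu> \<otimes> inv (lincomb U \<nu>)"
  using lincomb_add[of U \<mu> "\<lambda>x. - \<nu> x"] fin_supp_minus[of U \<nu>] lincomb_minus[of U \<nu>] assms by simp

lemma lincomb_nat_mult:
  assumes "U \<subseteq> carrier G" "fin_supp U \<nu>"
  shows "lincomb U (\<lambda>x. int n * \<nu> x) = lincomb U \<nu> [^] n"
proof (induction n)
  case (Suc n)
  then show ?case
    using lincomb_add[OF assms(1) fin_supp_mult[OF assms, of "int n"] assms(2)] assms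
    by (simp add: algebra_simps)
qed simp

lemma lincomb_mono_neutral:
  assumes "V \<subseteq> U" "U \<subseteq> carrier G"
  shows "lincomb V \<nu> = lincomb U (\<lambda>x. if x \<in> V then \<nu> x else 0)"
  unfolding lincomb_def using assms by (intro gfinprod_mono_neutral_cong_left) auto

lemma fin_supp_mono_neutral:
  "V \<subseteq> U \<Longrightarrow> fin_supp U (\<lambda>x. if x \<in> V then \<nu> x else 0) \<longleftrightarrow> fin_supp V \<nu>"
  unfolding fin_supp_def by (rule arg_cong[where f = finite]) auto

lemma fin_supp_finite: "finite {x \<in> U. \<nu> x \<noteq> 0} \<Longrightarrow> fin_supp U \<nu>"
  unfolding fin_supp_def by (erule finite_subset[rotated]) auto

lemma lincomb_single:
  assumes "U \<subseteq> carrier G" "x \<in> U"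
  shows "lincomb U (\<lambda>y. of_bool (x = y)) = x" "fin_supp U (\<lambda>y. of_bool (x = y))"
proof -
  show "fin_supp U (\<lambda>y. of_bool (x = y))"
    by (rule fin_supp_finite) auto
  have "lincomb {x} (\<lambda>y. 1) = x"
    using assms by (auto simp: lincomb_def)
  moreover have "lincomb {x} (\<lambda>y. 1) = lincomb U (\<lambda>y. if y \<in> {x} then 1 else 0)"
    using assms by (intro lincomb_mono_neutral) auto
  moreover have "\<dots> = lincomb U (\<lambda>y. of_bool (x = y))"
    using assms by (intro lincomb_cong) auto
  ultimately show "lincomb U (\<lambda>y. of_bool (x = y)) = x" by simp
qed

section \<open>Integer combinations and generated subgroups\<close>

lemma lincomb_in_subgroup:
  assumes H: "subgroup H G" and "\<And>x. x \<in> U \<Longrightarrow> x [^] \<nu> x \<in> H"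
  shows "lincomb U \<nu> \<in> H"
proof -
  have "finprod G (\<lambda>x. x [^] \<nu> x) F \<in> H" if "finite F" "F \<subseteq> U" for F
    using that
  proof (induction F)
    case empty
    then show ?case using subgroup.one_closed[OF H] by simp
  next
    case (insert x F)
    then have "(\<lambda>x. x [^] \<nu> x) \<in> insert x F \<rightarrow> carrier G"
      using assms subgroup.mem_carrier[OF H] by blast
    then show ?case using insert assms subgroup.m_closed[OF H] by (simp add: Pi_def)
  qed
  then show ?thesis
    using subgroup.one_closed[OF H] by (simp add: lincomb_def gfinprod_def)
qed

lemma lincomb_in_generate:
  assumes "U \<subseteq> carrier G"
  shows "lincomb U \<nu> \<in> generate G U"
proof (rule lincomb_in_subgroup)
  show "subgroup (generate G U) G"
    using assms by (rule generate_is_subgroup)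
  then show "x [^] \<nu> x \<in> generate G U" if "x \<in> U" for x
    using that by (intro subgroup_int_pow_closed generate.incl)
qed

lemma generate_lincombE:
  assumes U: "U \<subseteq> carrier G" and "g \<in> generate G U"
  obtains \<nu> where "fin_supp U \<nu>" "g = lincomb U \<nu>"
proof -
  have "\<exists>\<nu>. fin_supp U \<nu> \<and> g = lincomb U \<nu>"
    using assms(2)
  proof (induction rule: generate.induct)
    case one
    then show ?case by (metis fin_supp_zero lincomb_zero)
  next
    case (incl h)
    then show ?case using lincomb_single[OF U] by metis
  next
    case (inv h)
    then show ?case using lincomb_single[OF U] lincomb_minus[OF U] fin_supp_minus[OF U] by metis
  next
    case (eng h1 h2)
    then show ?case using lincomb_add[OF U] fin_supp_add[OF U] by metis
  qed
  then show thesis using that by blast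
qed

lemma independentD:
  assumes "U \<subseteq> carrier G" "independent U" "fin_supp U \<nu>" "lincomb U \<nu> = \<one>" "x \<in> U"
  shows "int (ord x) dvd \<nu> x"
  using assms int_pow_eq_id[of x "\<nu> x"] unfolding independent_def by blast

lemma independent_subset:
  assumes U: "U \<subseteq> carrier G" "independent U" and "V \<subseteq> U"
  shows "independent V"
  unfolding independent_def
proof (intro allI impI ballI; elim conjE)
  fix \<nu> x assume "fin_supp V \<nu>" "lincomb V \<nu> = \<one>" "x \<in> V"
  then have "int (ord x) dvd (if x \<in> V then \<nu> x else 0)"
    using assms by (intro independentD[OF U]) (auto simp: fin_supp_mono_neutral lincomb_mono_neutral[symmetric])
  then show "x [^] \<nu> x = \<one>"
    using \<open>x \<in> V\<close> assms by (auto simp: int_pow_eq_id)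
qed

subsection \<open>Coordinate functions of a pure direct sum of cyclic groups\<close>

text \<open>\<open>homogeneous_complement\<close> is applied with \<open>generate G V\<close> for
  \<open>C\<close> and with the product of \<open>generate G (U - V)\<close> and the group of all
  powers with exponent \<open>p ^ Suc m\<close> for \<open>L\<close>. Purity makes the two meet
  trivially.\<close>

lemma level_complement:
  assumes p: "Factorial_Ring.prime (p::nat)" and U: "U \<subseteq> carrier G" "independent U"
    and pure: "\<And>g. g \<in> carrier G \<Longrightarrow> g [^] (p ^ Suc m) \<in> generate G U
      \<Longrightarrow> \<exists>b \<in> generate G U. b [^] (p ^ Suc m) = g [^] (p ^ Suc m)"
  defines "V \<equiv> {x \<in> U. ord x = p ^ Suc m}"
  obtains K where "subgroup K G" "U - V \<subseteq> K" "K \<inter> generate G V = {\<one>}"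
    "K <#> generate G V = carrier G"
proof -
  define q where "q = p ^ Suc m"
  define P where "P = (\<lambda>g. g [^] q) ` carrier G"
  have VU: "V \<subseteq> U" by (auto simp: V_def)
  then have V: "V \<subseteq> carrier G" "independent V" and W: "U - V \<subseteq> carrier G"
    using U independent_subset by auto
  have ordV: "ord x = q" if "x \<in> V" for x
    using that by (simp add: V_def q_def)
  have P: "subgroup P G"
  proof (rule subgroupI)
    show "P \<subseteq> carrier G" "P \<noteq> {}" by (auto simp: P_def)
    show "inv a \<in> P" if "a \<in> P" for a
      using that unfolding P_def by (auto simp: nat_pow_inv[symmetric] simp del: nat_pow_inv)
    show "a \<otimes> b \<in> P" if "a \<in> P" "b \<in> P" for a b
      using that unfolding P_def by (auto simp: nat_pow_distrib[symmetric])
  qed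
  define L where "L = generate G (U - V) <#> P"
  have genW: "subgroup (generate G (U - V)) G" and genV: "subgroup (generate G V) G"
    and genU: "subgroup (generate G U) G"
    using V W U by (auto intro: generate_is_subgroup)
  have L: "subgroup L G" unfolding L_def using genW P by (rule mult_subgroups)
  have sub: "generate G (U - V) \<subseteq> L" "P \<subseteq> L"
    unfolding L_def using subset_set_mult[OF genW P] by auto
  \<comment> \<open>For \<open>z = a \<otimes> g [^] q\<close>, purity replaces \<open>g\<close> by
    some \<open>b\<close> in \<open>generate G U\<close>. Comparing the two resulting expansions of
    \<open>z\<close>, its coefficients on \<open>V\<close> are divisible by \<open>q\<close>, which
    is the order there.\<close>
  have "L \<inter> generate G V \<subseteq> {\<one>}"
  proof
    fix z assume z: "z \<in> L \<inter> generate G V"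
    obtain \<mu> where \<mu>: "fin_supp V \<mu>" "z = lincomb V \<mu>"
      using z generate_lincombE[OF V(1)] by blast
    obtain a g where ag: "a \<in> generate G (U - V)" "g \<in> carrier G" "z = a \<otimes> g [^] q"
      using z unfolding L_def P_def set_mult_def by blast
    obtain \<nu> where \<nu>: "fin_supp (U - V) \<nu>" "a = lincomb (U - V) \<nu>"
      using ag(1) generate_lincombE[OF W] by blast
    define \<mu>' where "\<mu>' = (\<lambda>x. if x \<in> V then \<mu> x else 0)"
    define \<nu>' where "\<nu>' = (\<lambda>x. if x \<in> U - V then \<nu> x else 0)"
    have \<mu>': "fin_supp U \<mu>'" "z = lincomb U \<mu>'" and \<nu>': "fin_supp U \<nu>'" "a = lincomb U \<nu>'"
      unfolding \<mu>'_def \<nu>'_def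
      using \<mu> \<nu> fin_supp_mono_neutral[OF VU] lincomb_mono_neutral[OF VU U(1)]
        fin_supp_mono_neutral[OF Diff_subset] lincomb_mono_neutral[OF Diff_subset U(1)] by auto
    have "g [^] q = inv a \<otimes> z"
      using ag U \<nu>' by (simp add: m_assoc[symmetric])
    then have "g [^] q \<in> generate G U"
      using \<mu>' \<nu>' lincomb_in_generate[OF U(1)] subgroup.m_closed[OF genU] subgroup.m_inv_closed[OF genU]
      by simp
    then obtain b where b: "b \<in> generate G U" "b [^] q = g [^] q"
      using pure[of g] ag(2) by (auto simp: q_def)
    then obtain \<beta> where \<beta>: "fin_supp U \<beta>" "b = lincomb U \<beta>"
      using generate_lincombE[OF U(1)] by blast
    define \<gamma> where "\<gamma> = (\<lambda>x. \<nu>' x + int q * \<beta> x)"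
    have \<gamma>: "fin_supp U \<gamma>" "z = lincomb U \<gamma>"
      unfolding \<gamma>_def using \<beta> \<nu>' b(2) ag(3) U
      by (auto simp: fin_supp_add fin_supp_mult lincomb_add lincomb_nat_mult)
    have "int q dvd \<mu> x" if x: "x \<in> V" for x
    proof -
      have "int (ord x) dvd \<mu>' x - \<gamma> x"
        using U \<mu>' \<gamma> x VU
        by (intro independentD[OF U]) (auto simp: fin_supp_diff lincomb_diff)
      then show ?thesis
        using x ordV[OF x] by (simp add: \<mu>'_def \<gamma>_def \<nu>'_def dvd_diff_left_iff)
    qed
    then have "lincomb V \<mu> = lincomb V (\<lambda>x. 0)"
      using V(1) ordV by (intro lincomb_cong) (auto simp: int_pow_eq_id)
    then show "z \<in> {\<one>}" using \<mu> by simp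
  qed
  then have LV: "L \<inter> generate G V = {\<one>}"
    using subgroup.one_closed[OF L] subgroup.one_closed[OF genV] by blast
  \<comment> \<open>Independence makes every coefficient of \<open>c\<close> divisible by
    \<open>p\<close>, so a root can be taken coefficientwise.\<close>
  have hom: "\<exists>d \<in> generate G V. c = d [^] p" if c: "c \<in> generate G V" "c [^] (p ^ m) = \<one>" for c
  proof -
    obtain \<mu> where \<mu>: "fin_supp V \<mu>" "c = lincomb V \<mu>"
      using c generate_lincombE[OF V(1)] by blast
    \<comment> \<open>The value 0 at trivial factors keeps the support finite: when
      \<open>x [^] \<mu> x = \<one>\<close>, the power with exponent
      \<open>\<mu> x div int p\<close> may still be nontrivial.\<close>
    define \<kappa> where "\<kappa> x = (if x [^] \<mu> x = \<one> then 0 else \<mu> x div int p)" for x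
    have "int p dvd \<mu> x" if x: "x \<in> V" for x
    proof -
      have "int (ord x) dvd int (p ^ m) * \<mu> x"
        using c(2) \<mu> V x
        by (intro independentD[OF V]) (simp_all add: fin_supp_mult lincomb_nat_mult del: of_nat_power)
      then have "int (p ^ m) * int p dvd int (p ^ m) * \<mu> x"
        using ordV[OF x] by (simp add: q_def mult.commute)
      then show ?thesis
        using p by (simp add: prime_gt_0_nat)
    qed
    then have \<kappa>: "x [^] (int p * \<kappa> x) = x [^] \<mu> x" if "x \<in> V" for x
      using that by (auto simp: \<kappa>_def)
    have fin: "fin_supp V \<kappa>"
      using \<mu>(1) unfolding fin_supp_def by (rule finite_subset[rotated]) (auto simp: \<kappa>_def)
    have "c = lincomb V (\<lambda>x. int p * \<kappa> x)"
      using \<mu>(2) \<kappa> V(1) by (auto intro: lincomb_cong)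
    also have "\<dots> = lincomb V \<kappa> [^] p"
      using lincomb_nat_mult[OF V(1) fin] .
    finally show ?thesis using lincomb_in_generate[OF V(1)] by blast
  qed
  have "g [^] (p ^ Suc m) \<in> L" if "g \<in> carrier G" for g
    using sub(2) that by (auto simp: P_def q_def)
  from homogeneous_complement[OF L genV p LV this hom]
  obtain K where "subgroup K G" "L \<subseteq> K" "K \<inter> generate G V = {\<one>}" "K <#> generate G V = carrier G"
    by blast
  moreover have "U - V \<subseteq> L"
    using sub(1) generate.incl[of _ "U - V" G] by blast
  ultimately show thesis using that by blast
qed

text \<open>The coordinates of \<open>g\<close> are the coefficients of its component in
  \<open>generate G V\<close> along \<open>K\<close>. They are unique only modulo the orders, hence
  the congruences.\<close>

lemma complement_coordinates:
  assumes V: "V \<subseteq> carrier G" "independent V"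
    and K: "subgroup K G" "K \<inter> generate G V = {\<one>}" "K <#> generate G V = carrier G"
  obtains c :: "'a \<Rightarrow> 'a \<Rightarrow> int" where
    "\<And>x g h. x \<in> V \<Longrightarrow> g \<in> carrier G \<Longrightarrow> h \<in> carrier G \<Longrightarrow> int (ord x) dvd c x (g \<otimes> h) - (c x g + c x h)"
    "\<And>x y. x \<in> V \<Longrightarrow> y \<in> V \<Longrightarrow> int (ord x) dvd c x y - of_bool (x = y)"
    "\<And>x k. x \<in> V \<Longrightarrow> k \<in> K \<Longrightarrow> int (ord x) dvd c x k"
    "\<And>g. g \<in> carrier G \<Longrightarrow> finite {x \<in> V. \<not> int (ord x) dvd c x g}"
proof -
  define good where "good g \<nu> \<longleftrightarrow> fin_supp V \<nu> \<and> g \<otimes> inv (lincomb V \<nu>) \<in> K" for g \<nu>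
  have carr: "k \<in> K \<Longrightarrow> k \<in> carrier G" for k
    using subgroup.mem_carrier[OF K(1)] .
  have "\<exists>\<nu>. good g \<nu>" if "g \<in> carrier G" for g
  proof -
    have "g \<in> K <#> generate G V"
      using that K(3) by simp
    then obtain k b where kb: "k \<in> K" "b \<in> generate G V" "g = k \<otimes> b"
      unfolding set_mult_def by blast
    then obtain \<nu> where \<nu>: "fin_supp V \<nu>" "b = lincomb V \<nu>"
      using generate_lincombE[OF V(1)] by blast
    then have "g \<otimes> inv (lincomb V \<nu>) = k"
      using kb V(1) carr by (simp add: m_assoc)
    then show ?thesis using \<nu> kb by (auto simp: good_def)
  qed
  then obtain N where N: "good g (N g)" if "g \<in> carrier G" for g by metis
  \<comment> \<open>Two expansions of \<open>g\<close> differ by a combination that lies in both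
    \<open>K\<close> and \<open>generate G V\<close>, hence is trivial, and independence
    applies.\<close>
  have unique: "int (ord x) dvd \<mu> x - \<nu> x" if "good g \<mu>" "good g \<nu>" "x \<in> V" "g \<in> carrier G" for g \<mu> \<nu> x
  proof -
    have "lincomb V (\<lambda>x. \<mu> x - \<nu> x) = lincomb V \<mu> \<otimes> inv (lincomb V \<nu>)"
      using that V by (intro lincomb_diff) (auto simp: good_def)
    also have "\<dots> = inv (g \<otimes> inv (lincomb V \<mu>)) \<otimes> (g \<otimes> inv (lincomb V \<nu>))"
      using that V by (simp add: inv_mult_group m_assoc inv_solve_left)
    also have "\<dots> \<in> K"
      using that subgroup.m_closed[OF K(1)] subgroup.m_inv_closed[OF K(1)] by (simp add: good_def)
    finally have "lincomb V (\<lambda>x. \<mu> x - \<nu> x) = \<one>"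
      using K(2) lincomb_in_generate[OF V(1)] by blast
    then show ?thesis
      using that V by (intro independentD[OF V]) (auto simp: good_def fin_supp_diff)
  qed
  show thesis
  proof (rule that[of "\<lambda>x g. N g x"])
    fix x g h assume *: "x \<in> V" "g \<in> carrier G" "h \<in> carrier G"
    have Ng: "good g (N g)" "good h (N h)" using N * by auto
    have "(g \<otimes> h) \<otimes> inv (lincomb V (N g) \<otimes> lincomb V (N h))
        = (g \<otimes> inv (lincomb V (N g))) \<otimes> (h \<otimes> inv (lincomb V (N h)))"
      using * V by (simp add: inv_mult m_ac)
    then have "good (g \<otimes> h) (\<lambda>x. N g x + N h x)"
      using Ng V subgroup.m_closed[OF K(1)] by (simp add: good_def fin_supp_add lincomb_add)
    then show "int (ord x) dvd N (g \<otimes> h) x - (N g x + N h x)"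
      using unique N[of "g \<otimes> h"] * by (metis (no_types, lifting) m_closed)
  next
    fix x y assume *: "x \<in> V" "y \<in> V"
    have "good y (\<lambda>x. of_bool (y = x))"
      using lincomb_single[OF V(1) *(2)] subgroup.one_closed[OF K(1)] V * by (auto simp: good_def)
    then have "int (ord x) dvd N y x - of_bool (y = x)"
      using * V by (intro unique[of y "N y" "\<lambda>x. of_bool (y = x)"] N) auto
    then show "int (ord x) dvd N y x - of_bool (x = y)"
      by (simp add: eq_commute)
  next
    fix x k assume *: "x \<in> V" "k \<in> K"
    then have "good k (\<lambda>x. 0)" by (simp add: good_def carr)
    then show "int (ord x) dvd N k x"
      using unique[of k "N k" "\<lambda>x. 0" x] N[of k] * carr by simp
  next
    fix g assume g: "g \<in> carrier G"
    have "{x \<in> V. \<not> int (ord x) dvd N g x} = {x \<in> V. x [^] N g x \<noteq> \<one>}"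
      using V(1) by (auto simp: int_pow_eq_id)
    then show "finite {x \<in> V. \<not> int (ord x) dvd N g x}"
      using N[OF g] by (simp add: good_def fin_supp_def)
  qed
qed

text \<open>The functions \<open>c x\<close> are coordinate functions of \<open>U\<close>, extended to \<open>G\<close>, and meaningful
  only modulo the order of \<open>x\<close>.\<close>

lemma coordinates:
  assumes p: "Factorial_Ring.prime (p::nat)" and U: "U \<subseteq> carrier G" "independent U"
    and ord: "\<And>x. x \<in> U \<Longrightarrow> \<exists>n. ord x = p ^ Suc n"
    and pure: "\<And>n g. g \<in> carrier G \<Longrightarrow> g [^] (p ^ n) \<in> generate G U
      \<Longrightarrow> \<exists>b \<in> generate G U. b [^] (p ^ n) = g [^] (p ^ n)"
  obtains c :: "'a \<Rightarrow> 'a \<Rightarrow> int" where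
    "\<And>x g h. x \<in> U \<Longrightarrow> g \<in> carrier G \<Longrightarrow> h \<in> carrier G \<Longrightarrow> int (ord x) dvd c x (g \<otimes> h) - (c x g + c x h)"
    "\<And>x y. x \<in> U \<Longrightarrow> y \<in> U \<Longrightarrow> int (ord x) dvd c x y - of_bool (x = y)"
    "\<And>g m. g \<in> carrier G \<Longrightarrow> finite {x \<in> U. ord x = m \<and> \<not> int (ord x) dvd c x g}"
proof -
  define V where "V m = {x \<in> U. ord x = m}" for m
  define good :: "nat \<Rightarrow> ('a \<Rightarrow> 'a \<Rightarrow> int) \<Rightarrow> bool" where "good m c \<longleftrightarrow>
    (\<forall>x\<in>V m. \<forall>g\<in>carrier G. \<forall>h\<in>carrier G. int (ord x) dvd c x (g \<otimes> h) - (c x g + c x h)) \<and>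
    (\<forall>x\<in>V m. \<forall>y\<in>U. int (ord x) dvd c x y - of_bool (x = y)) \<and>
    (\<forall>g\<in>carrier G. finite {x \<in> V m. \<not> int (ord x) dvd c x g})" for m c
  \<comment> \<open>The complement depends on the order \<open>m\<close>, so each level is treated
    separately and the families are merged afterwards at \<open>m = ord x\<close>.\<close>
  have "\<exists>c. good m c" for m
  proof (cases "\<exists>n. m = p ^ Suc n")
    case True
    then obtain n where m: "m = p ^ Suc n" by blast
    have VU: "V m \<subseteq> U" by (auto simp: V_def)
    then have V: "V m \<subseteq> carrier G" "independent (V m)"
      using U independent_subset by auto
    obtain K where K: "subgroup K G" "U - V m \<subseteq> K" "K \<inter> generate G (V m) = {\<one>}"
      "K <#> generate G (V m) = carrier G"
      using level_complement[OF p U pure, of n] unfolding V_def m by blast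
    obtain c where c:
      "\<And>x g h. x \<in> V m \<Longrightarrow> g \<in> carrier G \<Longrightarrow> h \<in> carrier G \<Longrightarrow> int (ord x) dvd c x (g \<otimes> h) - (c x g + c x h)"
      "\<And>x y. x \<in> V m \<Longrightarrow> y \<in> V m \<Longrightarrow> int (ord x) dvd c x y - of_bool (x = y)"
      "\<And>x k. x \<in> V m \<Longrightarrow> k \<in> K \<Longrightarrow> int (ord x) dvd c x k"
      "\<And>g. g \<in> carrier G \<Longrightarrow> finite {x \<in> V m. \<not> int (ord x) dvd c x g}"
      using complement_coordinates[OF V K(1,3,4)] by blast
    \<comment> \<open>Basis elements of other orders lie in \<open>K\<close>, so the coordinate at
      \<open>x\<close> vanishes on them.\<close>
    have "int (ord x) dvd c x y - of_bool (x = y)" if "x \<in> V m" "y \<in> U" for x y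
    proof (cases "y \<in> V m")
      case False
      then have "x \<noteq> y" using that by blast
      then show ?thesis using c(3)[of x y] K(2) that False by auto
    qed (use c(2) that in blast)
    then have "good m c" unfolding good_def using c(1,4) by blast
    then show ?thesis by blast
  next
    case False
    then have "V m = {}" using ord by (auto simp: V_def)
    then show ?thesis by (simp add: good_def)
  qed
  then obtain C where C: "\<And>m. good m (C m)" by metis
  show thesis
  proof (rule that[of "\<lambda>x. C (ord x) x"])
    fix g m assume "g \<in> carrier G"
    then have "finite {x \<in> V m. \<not> int (ord x) dvd C m x g}"
      using C[of m] by (simp add: good_def)
    then show "finite {x \<in> U. ord x = m \<and> \<not> int (ord x) dvd C (ord x) x g}"
      by (rule finite_subset[rotated]) (auto simp: V_def)
  qed (use C in \<open>auto simp: good_def V_def\<close>)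
qed

subsection \<open>Surjections onto a direct sum of cyclic groups\<close>

text \<open>The map sends \<open>g\<close> to the combination with coefficients
  \<open>d x g\<close>: \<open>fin\<close> makes it finite, \<open>add\<close> makes it
  multiplicative, and \<open>surj\<close> gives every generator a preimage.\<close>

lemma surj_hom_of_functionals:
  fixes d :: "'a \<Rightarrow> 'a \<Rightarrow> int"
  assumes U: "U \<subseteq> carrier G"
    and add: "\<And>x g h. x \<in> U \<Longrightarrow> g \<in> carrier G \<Longrightarrow> h \<in> carrier G
      \<Longrightarrow> int (ord x) dvd d x (g \<otimes> h) - (d x g + d x h)"
    and fin: "\<And>g. g \<in> carrier G \<Longrightarrow> finite {x \<in> U. \<not> int (ord x) dvd d x g}"
    and surj: "\<And>x. x \<in> U \<Longrightarrow> \<exists>y \<in> carrier G. \<forall>z \<in> U. int (ord z) dvd d z y - of_bool (x = z)"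
  obtains f where "f \<in> hom G (G\<lparr>carrier := generate G U\<rparr>)" "f ` carrier G = generate G U"
proof -
  define f where "f g = lincomb U (\<lambda>x. d x g)" for g
  have supp: "fin_supp U (\<lambda>x. d x g)" if "g \<in> carrier G" for g
  proof -
    have "{x \<in> U. x [^] d x g \<noteq> \<one>} = {x \<in> U. \<not> int (ord x) dvd d x g}"
      using U by (auto simp: int_pow_eq_id)
    then show ?thesis using fin[OF that] by (simp add: fin_supp_def)
  qed
  have cong: "lincomb U \<mu> = lincomb U \<nu>" if "\<And>x. x \<in> U \<Longrightarrow> int (ord x) dvd \<mu> x - \<nu> x" for \<mu> \<nu>
  proof (rule lincomb_cong[OF U])
    fix x assume "x \<in> U"
    then show "x [^] \<mu> x = x [^] \<nu> x"
      using that[of x] U int_pow_eq[of x "\<mu> x" "\<nu> x"] by (auto simp: dvd_diff_commute)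
  qed
  have mult: "f (g \<otimes> h) = f g \<otimes> f h" if "g \<in> carrier G" "h \<in> carrier G" for g h
    unfolding f_def lincomb_add[OF U supp[OF that(1)] supp[OF that(2)], symmetric]
    by (rule cong) (use add that in blast)
  have hom: "f \<in> hom G G"
    using mult U by (auto simp: hom_def f_def)
  have sub: "f ` carrier G \<subseteq> generate G U"
    by (auto simp: f_def lincomb_in_generate[OF U])
  interpret f: group_hom G G f
    using hom by unfold_locales
  have "U \<subseteq> f ` carrier G"
  proof
    fix x assume x: "x \<in> U"
    then obtain y where y: "y \<in> carrier G" "\<And>z. z \<in> U \<Longrightarrow> int (ord z) dvd d z y - of_bool (x = z)"
      using surj by blast
    have "f y = lincomb U (\<lambda>z. of_bool (x = z))"
      unfolding f_def by (rule cong) (use y(2) in blast)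
    then have "f y = x" using lincomb_single[OF U x] by simp
    then show "x \<in> f ` carrier G" using y(1) by blast
  qed
  then have "generate G U \<subseteq> f ` carrier G"
    using f.img_is_subgroup by (rule generate_subgroup_incl)
  with sub have "f ` carrier G = generate G U" by blast
  moreover have "f \<in> hom G (G\<lparr>carrier := generate G U\<rparr>)"
    using mult sub by (auto simp: hom_def)
  ultimately show thesis using that by blast
qed

section \<open>Additive functions modulo \<open>q\<close> on powers and torsion elements, and the
  quotient by \<open>T\<close>\<close>

lemma functional_nat_pow:
  fixes \<phi> :: "'a \<Rightarrow> int"
  assumes add: "\<And>g h. g \<in> carrier G \<Longrightarrow> h \<in> carrier G \<Longrightarrow> q dvd \<phi> (g \<otimes> h) - (\<phi> g + \<phi> h)"
    and a: "a \<in> carrier G"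
  shows "q dvd \<phi> (a [^] n) - int n * \<phi> a"
proof (induction n)
  case 0
  \<comment> \<open>Additivity at \<open>\<one> \<otimes> \<one> = \<one>\<close> shows that the
    value at \<open>\<one>\<close> vanishes modulo \<open>q\<close>.\<close>
  have "q dvd - \<phi> \<one>" using add[of \<one> \<one>] by simp
  then show ?case by simp
next
  case (Suc n)
  have "q dvd \<phi> (a [^] n \<otimes> a) - (\<phi> (a [^] n) + \<phi> a)" using add a by simp
  from dvd_add[OF this Suc] show ?case by (simp add: algebra_simps)
qed

lemma functional_torsion:
  fixes \<phi> :: "'a \<Rightarrow> int"
  assumes add: "\<And>g h. g \<in> carrier G \<Longrightarrow> h \<in> carrier G \<Longrightarrow> q dvd \<phi> (g \<otimes> h) - (\<phi> g + \<phi> h)"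
    and a: "a \<in> carrier G" "a [^] (N::nat) = \<one>"
  shows "q dvd int N * \<phi> a"
proof -
  have "q dvd \<phi> (a [^] N) - int N * \<phi> a" "q dvd \<phi> (a [^] (0::nat)) - int 0 * \<phi> a"
    using functional_nat_pow[of q \<phi>, OF add a(1)] by blast+
  then have "q dvd \<phi> \<one> - int N * \<phi> a" "q dvd \<phi> \<one>"
    using a(2) by simp_all
  then show ?thesis by (simp add: dvd_diff_right_iff)
qed

lemma countable_quotient_representatives:
  assumes T: "subgroup T G" and "countable (carrier (G Mod T))"
  obtains r :: "nat \<Rightarrow> 'a" where "\<And>j. r j \<in> carrier G"
    "\<And>g. g \<in> carrier G \<Longrightarrow> \<exists>j. \<exists>t\<in>T. g = t \<otimes> r j"
proof -
  define s where "s C = (SOME x. x \<in> carrier G \<and> C = T #> x)" for C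
  \<comment> \<open>\<open>from_nat_into\<close> enumerates a nonempty countable set with possible
    repetitions, so finite quotients are covered as well.\<close>
  define r where "r j = s (from_nat_into (carrier (G Mod T)) j)" for j
  have ne: "carrier (G Mod T) \<noteq> {}" by (auto simp: carrier_FactGroup)
  have s: "s C \<in> carrier G" "C = T #> s C" if "C \<in> carrier (G Mod T)" for C
    using that someI_ex[of "\<lambda>x. x \<in> carrier G \<and> C = T #> x"]
    by (auto simp: carrier_FactGroup s_def)
  have "r j \<in> carrier G" for j
    using s(1)[OF from_nat_into[OF ne]] by (simp add: r_def)
  moreover have "\<exists>j. \<exists>t\<in>T. g = t \<otimes> r j" if g: "g \<in> carrier G" for g
  proof -
    have C: "T #> g \<in> carrier (G Mod T)" using g by (auto simp: carrier_FactGroup)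
    then obtain j where j: "from_nat_into (carrier (G Mod T)) j = T #> g"
      using from_nat_into_surj[OF assms(2)] by blast
    have "g \<in> T #> r j"
      using s(2)[OF C] rcos_self[OF g T] by (simp add: r_def j)
    then show ?thesis by (auto simp: r_coset_def)
  qed
  ultimately show thesis using that by blast
qed

text \<open>The coset of \<open>g\<close> is a torsion element of the quotient. This brings roots
  taken in \<open>G\<close> back into \<open>T\<close>, where purity is known.\<close>

lemma torsion_free_quotient_pow:
  assumes T: "subgroup T G" and tf: "torsion_free (G Mod T)"
    and g: "g \<in> carrier G" "g [^] (n::nat) \<in> T" "n > 0"
  shows "g \<in> T"
proof -
  interpret normal T G using T by (rule subgroup_imp_normal)
  have "(T #> g) [^]\<^bsub>G Mod T\<^esub> n = T #> (g [^] n)"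
    using g(1) by (rule FactGroup_pow)
  also have "\<dots> = \<one>\<^bsub>G Mod T\<^esub>"
    using coset_join2[OF _ T g(2)] g(1) by simp
  finally have "T #> g = \<one>\<^bsub>G Mod T\<^esub>"
    using tf g(1,3) unfolding torsion_free_def carrier_FactGroup by blast
  then show ?thesis using coset_join1[of T g] g(1) T by simp
qed

text \<open>The functions \<open>c x\<close> may fail only the finiteness required by
  \<open>surj_hom_of_functionals\<close>. Altering them on a tail \<open>D\<close> of large orders
  restores it and keeps a preimage for every generator.\<close>

lemma ex_surj_hom_generate:
  fixes c :: "'a \<Rightarrow> 'a \<Rightarrow> int" and r :: "nat \<Rightarrow> 'a"
  assumes p: "Factorial_Ring.prime (p::nat)" and U: "U \<subseteq> carrier G"
    and ord: "\<And>x. x \<in> U \<Longrightarrow> \<exists>n. ord x = p ^ n"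
    and add: "\<And>x g h. x \<in> U \<Longrightarrow> g \<in> carrier G \<Longrightarrow> h \<in> carrier G
      \<Longrightarrow> int (ord x) dvd c x (g \<otimes> h) - (c x g + c x h)"
    and delta: "\<And>x y. x \<in> U \<Longrightarrow> y \<in> U \<Longrightarrow> int (ord x) dvd c x y - of_bool (x = y)"
    and fin: "\<And>g m. g \<in> carrier G \<Longrightarrow> finite {x \<in> U. ord x = m \<and> \<not> int (ord x) dvd c x g}"
    and T: "T \<subseteq> carrier G" "torsion_set G T"
    and r: "\<And>j. r j \<in> carrier G" "\<And>g. g \<in> carrier G \<Longrightarrow> \<exists>j. \<exists>t\<in>T. g = t \<otimes> r j"
  obtains f where "f \<in> hom G (G\<lparr>carrier := generate G U\<rparr>)" "f ` carrier G = generate G U"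
proof -
  have pos: "ord x > 0" if "x \<in> U" for x
    using ord[OF that] p prime_gt_0_nat by fastforce
  have dvd: "ord x dvd ord y" if "x \<in> U" "y \<in> U" "ord x \<le> ord y" for x y
  proof -
    obtain i j where "ord x = p ^ i" "ord y = p ^ j" using ord \<open>x \<in> U\<close> \<open>y \<in> U\<close> by blast
    then show ?thesis
      using that(3) prime_gt_1_nat[OF p] by (simp add: le_imp_power_dvd)
  qed
  have finle: "finite {x \<in> U. ord x \<le> m \<and> \<not> int (ord x) dvd c x g}" if "g \<in> carrier G" for g m
  proof -
    have "{x \<in> U. ord x \<le> m \<and> \<not> int (ord x) dvd c x g}
        = (\<Union>i\<le>m. {x \<in> U. ord x = i \<and> \<not> int (ord x) dvd c x g})"
      by auto
    then show ?thesis using fin[OF that] by simp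
  qed
  \<comment> \<open>A tail of least cardinality leaves room for partners of arbitrarily large order;
    the orders up to \<open>m\<close> are handled by \<open>finle\<close>.\<close>
  obtain m where m: "\<And>n. card_of {x \<in> U. m \<le> ord x} \<le>o card_of {x \<in> U. m \<le> ord x \<and> n \<le> ord x}"
    using ex_minimal_tail[of U ord] by blast
  define D where "D = {x \<in> U. m \<le> ord x}"
  have DU: "D \<subseteq> U" by (auto simp: D_def)
  have tail: "|D| \<le>o card_of {x \<in> D. n \<le> ord x}" for n
    using m[of n] by (simp add: D_def conj_assoc)
  have posD: "\<And>x. x \<in> D \<Longrightarrow> ord x > 0"
    and dvdD: "\<And>x y. x \<in> D \<Longrightarrow> y \<in> D \<Longrightarrow> ord x \<le> ord y \<Longrightarrow> ord x dvd ord y"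
    using pos dvd DU by auto
  have finD: "finite {x \<in> D. ord x = n \<and> \<not> int (ord x) dvd c x (r j)}" for n j
    using fin[OF r(1), of n j] by (rule finite_subset[rotated]) (use DU in auto)
  obtain k l where kl:
    "\<And>x. x \<in> D \<Longrightarrow> k x \<in> D" "\<And>x. x \<in> D \<Longrightarrow> l x \<in> D"
    "\<And>x. x \<in> D \<Longrightarrow> (ord x)\<^sup>2 \<le> ord (k x)" "\<And>x. x \<in> D \<Longrightarrow> (ord x)\<^sup>2 \<le> ord (l x)"
    "inj_on k D" "inj_on l D" "\<And>x y. x \<in> D \<Longrightarrow> y \<in> D \<Longrightarrow> k x \<noteq> l y"
    "\<And>j. finite {x \<in> D. \<not> int (ord x) dvd c (k x) (r j) - c (l x) (r j)}"
  proof -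
    show thesis
    proof (rule ex_partner_indices[of D ord "\<lambda>x j. c x (r j)"], goal_cases)
      case (1 n)
      show ?case by (rule tail)
    next
      case (2 x)
      then show ?case by (rule posD)
    next
      case (3 x y)
      then show ?case by (rule dvdD)
    next
      case (4 n j)
      show ?case by (rule finD)
    next
      case (5 k l)
      show ?case by (rule that[OF 5])
    qed
  qed
  have sq: "n \<le> n\<^sup>2" for n :: nat by (simp add: power2_eq_square)
  have dvdh: "int (ord x) dvd int (ord y)"
    if "x \<in> D" "y \<in> D" "(ord x)\<^sup>2 \<le> ord y" for x y
    using dvdD[OF that(1,2)] that(3) sq[of "ord x"] by simp
  \<comment> \<open>Let \<open>N\<close> annihilate \<open>t\<close>. A nonzero coordinate forces
    \<open>ord (h x) \<le> N * ord x\<close>; with \<open>(ord x)\<^sup>2 \<le> ord (h x)\<close>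
    this gives \<open>ord x \<le> N\<close> and \<open>ord (h x) \<le> N * N\<close>. Only finitely
    many \<open>h x\<close> qualify, and \<open>h\<close> is injective.\<close>
  have torsion: "finite {x \<in> D. \<not> int (ord x) dvd c (h x) t}"
    if h: "inj_on h D" "\<And>x. x \<in> D \<Longrightarrow> h x \<in> D" "\<And>x. x \<in> D \<Longrightarrow> (ord x)\<^sup>2 \<le> ord (h x)" and t: "t \<in> T"
    for h t
  proof -
    obtain N :: nat where N: "N > 0" "t [^] N = \<one>" using T(2) t unfolding torsion_set_def by blast
    have tG: "t \<in> carrier G" using T(1) t by blast
    have "h ` {x \<in> D. \<not> int (ord x) dvd c (h x) t} \<subseteq> {y \<in> U. ord y \<le> N * N \<and> \<not> int (ord y) dvd c y t}"
    proof (intro image_subsetI)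
      fix x assume "x \<in> {x \<in> D. \<not> int (ord x) dvd c (h x) t}"
      then have x: "x \<in> D" "\<not> int (ord x) dvd c (h x) t" by auto
      have hx: "h x \<in> U" using h(2)[OF x(1)] DU by blast
      have "int (ord (h x)) dvd int N * c (h x) t"
        using add[OF hx] tG N(2) by (rule functional_torsion)
      then have le: "ord (h x) \<le> N * ord x"
        using ord[OF hx] ord[of x] x DU prime_power_le_mult[OF p _ _ N(1)] by (metis subsetD)
      with h(3)[OF x(1)] have "ord x * ord x \<le> N * ord x"
        unfolding power2_eq_square by linarith
      then have "ord x \<le> N" using posD[OF x(1)] mult_le_cancel2 by blast
      with le have "ord (h x) \<le> N * N" by (meson le_trans mult_le_mono2)
      moreover have "\<not> int (ord (h x)) dvd c (h x) t"
        using x(2) dvdh[OF x(1) h(2,3)[OF x(1)]] dvd_trans by blast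
      ultimately show "h x \<in> {y \<in> U. ord y \<le> N * N \<and> \<not> int (ord y) dvd c y t}"
        using hx by blast
    qed
    then have "finite (h ` {x \<in> D. \<not> int (ord x) dvd c (h x) t})"
      using finle[OF tG] by (rule finite_subset)
    then show ?thesis
      by (rule finite_imageD) (rule inj_on_subset[OF h(1)], blast)
  qed
  \<comment> \<open>The difference is still additive modulo \<open>ord x\<close>, because
    \<open>ord x\<close> divides the orders of both partners.\<close>
  define d where "d x g = (if x \<in> D then c (k x) g - c (l x) g else c x g)" for x g
  have d_add: "int (ord x) dvd d x (g \<otimes> h) - (d x g + d x h)"
    if "x \<in> U" "g \<in> carrier G" "h \<in> carrier G" for x g h
  proof (cases "x \<in> D")
    case True
    have "int (ord x) dvd c (k x) (g \<otimes> h) - (c (k x) g + c (k x) h)"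
      using dvdh[OF True kl(1,3)[OF True]] add[of "k x" g h] kl(1)[OF True] DU that by (metis dvd_trans subsetD)
    moreover have "int (ord x) dvd c (l x) (g \<otimes> h) - (c (l x) g + c (l x) h)"
      using dvdh[OF True kl(2,4)[OF True]] add[of "l x" g h] kl(2)[OF True] DU that by (metis dvd_trans subsetD)
    ultimately have "int (ord x) dvd (c (k x) (g \<otimes> h) - (c (k x) g + c (k x) h))
        - (c (l x) (g \<otimes> h) - (c (l x) g + c (l x) h))"
      by (rule dvd_diff)
    then show ?thesis using True by (simp add: d_def algebra_simps)
  qed (use add that in \<open>simp add: d_def\<close>)
  have d_fin: "finite {x \<in> U. \<not> int (ord x) dvd d x g}" if g: "g \<in> carrier G" for g
  proof -
    obtain j t where jt: "t \<in> T" "g = t \<otimes> r j" using r(2)[OF g] by blast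
    have tG: "t \<in> carrier G" using T(1) jt by blast
    \<comment> \<open>Exceptions off \<open>D\<close> have small order; those on \<open>D\<close>
      come from the torsion part \<open>t\<close> or from the representative
      \<open>r j\<close>.\<close>
    have "{x \<in> U. \<not> int (ord x) dvd d x g} \<subseteq>
        {x \<in> U. ord x \<le> m \<and> \<not> int (ord x) dvd c x g}
        \<union> ({x \<in> D. \<not> int (ord x) dvd c (k x) t} \<union> {x \<in> D. \<not> int (ord x) dvd c (l x) t})
        \<union> {x \<in> D. \<not> int (ord x) dvd c (k x) (r j) - c (l x) (r j)}" (is "_ \<subseteq> ?A \<union> (?B \<union> ?C) \<union> ?E")
    proof
      fix x assume "x \<in> {x \<in> U. \<not> int (ord x) dvd d x g}"
      then have x: "x \<in> U" "\<not> int (ord x) dvd d x g" by auto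
      show "x \<in> ?A \<union> (?B \<union> ?C) \<union> ?E"
      proof (cases "x \<in> D")
        case False
        then show ?thesis using x by (simp add: d_def D_def)
      next
        case True
        have "\<not> (int (ord x) dvd d x t \<and> int (ord x) dvd d x (r j))"
          using d_add[OF x(1) tG r(1), of j] x(2) jt(2)
          by (metis dvd_add dvd_diff_left_iff)
        then show ?thesis using True by (auto simp: d_def)
      qed
    qed
    then show ?thesis
      using finite_subset finle[OF g] torsion[OF kl(5,1,3) jt(1)] torsion[OF kl(6,2,4) jt(1)] kl(8)
      by (meson finite_UnI)
  qed
  have d_surj: "\<exists>y \<in> carrier G. \<forall>z \<in> U. int (ord z) dvd d z y - of_bool (x = z)" if x: "x \<in> U" for x
  proof (cases "x \<in> D")
    case False
    \<comment> \<open>Partners lie in \<open>D\<close>, so an \<open>x\<close> outside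
      \<open>D\<close> has zero coordinate at all of them and is its own preimage.\<close>
    have "int (ord z) dvd d z x - of_bool (x = z)" if z: "z \<in> U" for z
    proof (cases "z \<in> D")
      case True
      then have "k z \<noteq> x" "l z \<noteq> x" "x \<noteq> z" using False kl(1,2) by blast+
      moreover have "k z \<in> U" "l z \<in> U" using True kl(1,2) DU by blast+
      ultimately have "int (ord (k z)) dvd c (k z) x" "int (ord (l z)) dvd c (l z) x"
        using delta[of "k z" x] delta[of "l z" x] x by auto
      then have "int (ord z) dvd c (k z) x - c (l z) x"
        using dvdh[OF True kl(1,3)[OF True]] dvdh[OF True kl(2,4)[OF True]] by (meson dvd_diff dvd_trans)
      then show ?thesis using True \<open>x \<noteq> z\<close> by (simp add: d_def)
    qed (use delta[OF z x] in \<open>simp add: d_def eq_commute\<close>)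
    then show ?thesis using x U by blast
  next
    case xD: True
    have kx: "k x \<in> D" "k x \<in> U" using kl(1)[OF xD] DU by auto
    \<comment> \<open>For \<open>x\<close> in \<open>D\<close> the preimage is \<open>k x\<close>:
      injectivity of \<open>k\<close> isolates the index \<open>x\<close>, and no \<open>l z\<close>
      equals \<open>k x\<close>.\<close>
    have "int (ord z) dvd d z (k x) - of_bool (x = z)" if z: "z \<in> U" for z
    proof (cases "z \<in> D")
      case True
      have "k z \<in> U" "l z \<in> U" using True kl(1,2) DU by blast+
      then have "int (ord (k z)) dvd c (k z) (k x) - of_bool (k z = k x)"
        "int (ord (l z)) dvd c (l z) (k x) - of_bool (l z = k x)"
        using delta kx(2) by blast+
      then have "int (ord z) dvd c (k z) (k x) - of_bool (k z = k x)"
        "int (ord z) dvd c (l z) (k x) - of_bool (l z = k x)"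
        using dvdh[OF True kl(1,3)[OF True]] dvdh[OF True kl(2,4)[OF True]] by (meson dvd_trans)+
      then have "int (ord z) dvd (c (k z) (k x) - of_bool (k z = k x)) - (c (l z) (k x) - of_bool (l z = k x))"
        by (rule dvd_diff)
      moreover have "k z = k x \<longleftrightarrow> x = z" using kl(5) True xD by (auto simp: inj_on_def)
      moreover have "l z \<noteq> k x" using kl(7)[OF xD True] by simp
      ultimately show ?thesis using True by (simp add: d_def algebra_simps)
    next
      case False
      then have "z \<noteq> k x" "x \<noteq> z" using kx(1) xD by blast+
      then show ?thesis using delta[OF z kx(2)] False by (simp add: d_def)
    qed
    then show ?thesis using kx(2) U by blast
  qed
  show thesis
    using surj_hom_of_functionals[OF U d_add d_fin d_surj] that by blast
qed

text \<open>Discarding \<open>\<one>\<close> leaves the generated subgroup unchanged and ensures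
  that every element of the basis has order different from 1.\<close>

lemma ex_independent_generators:
  assumes "B \<subseteq> carrier G" "direct_sum_of_cyclics G B"
  obtains U where "U \<subseteq> B" "\<one> \<notin> U" "generate G U = B" "independent U"
proof -
  obtain S where S: "S \<subseteq> B" "generate G S = B"
    and ind: "\<And>F (n :: 'a \<Rightarrow> int) x. finite F \<Longrightarrow> F \<subseteq> S \<Longrightarrow> finprod G (\<lambda>x. x [^] n x) F = \<one>
      \<Longrightarrow> x \<in> F \<Longrightarrow> x [^] n x = \<one>"
    using assms(2) unfolding direct_sum_of_cyclics_def by blast
  define U where "U = S - {\<one>}"
  have UG: "U \<subseteq> carrier G" using S(1) assms(1) by (auto simp: U_def)
  have "S \<subseteq> generate G U"
    using generate.incl[of _ U G] generate.one[of G U] by (auto simp: U_def)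
  then have "B \<subseteq> generate G U"
    using generate_subgroup_incl generate_is_subgroup[OF UG] S(2) by blast
  moreover have "generate G U \<subseteq> B"
    using mono_generate[of U S] S(2) by (auto simp: U_def)
  moreover have "independent U"
    unfolding independent_def
  proof (intro allI impI ballI; elim conjE)
    fix \<nu> x assume *: "fin_supp U \<nu>" "lincomb U \<nu> = \<one>" "x \<in> U"
    \<comment> \<open>The finite set to test is the support of \<open>\<nu>\<close>; if
      \<open>x\<close> belonged to it, its factor would be both trivial and nontrivial.\<close>
    show "x [^] \<nu> x = \<one>"
      using ind[of "{x \<in> U. x [^] \<nu> x \<noteq> \<one>}" \<nu> x] *
      by (auto simp: fin_supp_def lincomb_def gfinprod_def U_def)
  qed
  ultimately show thesis using that[of U] S(1) by (auto simp: U_def)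
qed

end

section \<open>From purity in the primary component to purity in \<open>G\<close>, and the resulting
  surjection\<close>

theorem theorem3p1:
  fixes G (structure) and T :: "'a set" and p :: nat and Bp :: "'a set"
  assumes "comm_group G"
    and "subgroup T G" and "torsion_set G T"
    and "countable (carrier (G Mod T))" and "torsion_free (G Mod T)"
    and "Factorial_Ring.prime p"
    and "basic_subgroup G Bp (primary_component G p T)"
  shows "\<exists>f. f \<in> hom G (G\<lparr>carrier := Bp\<rparr>) \<and> f ` carrier G = Bp"
proof -
  interpret comm_group G by fact
  note T = assms(2) and p = assms(6)
  have B: "subgroup Bp G" "Bp \<subseteq> primary_component G p T" "direct_sum_of_cyclics G Bp"
    and pure: "pure_in G Bp (primary_component G p T)"
    using assms(7) by (auto simp: basic_subgroup_def)
  have TG: "T \<subseteq> carrier G" using T by (rule subgroup.subset)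
  obtain U where U: "U \<subseteq> Bp" "\<one> \<notin> U" "generate G U = Bp" "independent U"
    using ex_independent_generators[OF subgroup.subset[OF B(1)] B(3)] by blast
  have UG: "U \<subseteq> carrier G" using U(1) subgroup.subset[OF B(1)] by blast
  have ordU: "\<exists>n. ord x = p ^ Suc n" if x: "x \<in> U" for x
  proof -
    obtain k where "x [^] (p ^ k) = \<one>" using x U(1) B(2) by (auto simp: primary_component_def)
    then have "ord x dvd p ^ k" using pow_eq_id[of x "p ^ k"] x UG by blast
    then obtain i where i: "ord x = p ^ i" using divides_primepow_nat[OF p] by blast
    have "i \<noteq> 0"
    proof
      assume "i = 0"
      then have "x = \<one>" using i ord_eq_1[of x] x UG by auto
      then show False using x U(2) by blast
    qed
    then show ?thesis using i by (metis not0_implies_Suc)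
  qed
  \<comment> \<open>A root \<open>g\<close> of an element of \<open>Bp\<close> lies in
    \<open>T\<close> because the quotient is torsion-free, and it has p-power order because the
    element does. So it lies in the primary component, where \<open>Bp\<close> is pure.\<close>
  have "\<exists>b \<in> generate G U. b [^] (p ^ n) = g [^] (p ^ n)"
    if g: "g \<in> carrier G" "g [^] (p ^ n) \<in> generate G U" for n g
  proof -
    have gB: "g [^] (p ^ n) \<in> Bp" using g U(3) by simp
    then have "g [^] (p ^ n) \<in> primary_component G p T" using B(2) by blast
    then obtain k where k: "g [^] (p ^ n) \<in> T" "(g [^] (p ^ n)) [^] (p ^ k) = \<one>"
      by (auto simp: primary_component_def)
    then have "g \<in> T"
      using torsion_free_quotient_pow[OF T assms(5) g(1)] prime_gt_0_nat[OF p] by simp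
    moreover have "g [^] (p ^ (n + k)) = \<one>"
      using k(2) g(1) by (simp add: nat_pow_pow power_add)
    ultimately have "g \<in> primary_component G p T"
      by (auto simp: primary_component_def)
    then show ?thesis using pure gB U(3) unfolding pure_in_def by blast
  qed
  from coordinates[OF p UG U(4) ordU this]
  obtain c :: "'a \<Rightarrow> 'a \<Rightarrow> int" where c:
    "\<And>x g h. x \<in> U \<Longrightarrow> g \<in> carrier G \<Longrightarrow> h \<in> carrier G \<Longrightarrow> int (ord x) dvd c x (g \<otimes> h) - (c x g + c x h)"
    "\<And>x y. x \<in> U \<Longrightarrow> y \<in> U \<Longrightarrow> int (ord x) dvd c x y - of_bool (x = y)"
    "\<And>g m. g \<in> carrier G \<Longrightarrow> finite {x \<in> U. ord x = m \<and> \<not> int (ord x) dvd c x g}"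
    by blast
  obtain r :: "nat \<Rightarrow> 'a" where r: "\<And>j. r j \<in> carrier G"
    "\<And>g. g \<in> carrier G \<Longrightarrow> \<exists>j. \<exists>t\<in>T. g = t \<otimes> r j"
    using countable_quotient_representatives[OF T assms(4)] by blast
  have ordU': "\<exists>n. ord x = p ^ n" if "x \<in> U" for x
    using ordU[OF that] by blast
  obtain f where "f \<in> hom G (G\<lparr>carrier := generate G U\<rparr>)" "f ` carrier G = generate G U"
    by (rule ex_surj_hom_generate[OF p UG ordU' c TG assms(3) r])
  then show ?thesis unfolding U(3) by blast
qed

end
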